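(* Let $D$ be a dendriform algebra over a field $k$ of characteristic zero and $\overline D=D\oplus k\mathbf 1$ its unital augmentation. Let $b,c\in D$ and let $Y,Z\in\overline D[[\lambda]]$ satisfy $$Y=\mathbf 1+\lambda\, c\prec Y,\qquad Z=\mathbf 1+\lambda\, Z\succ b .$$ Then for every $a\in D$ the element $$X:=Y*\bigl(Y^{-1}\succ a\prec Z^{-1}\bigr)*Z$$ satisfies $$X=a+\lambda\, X\succ b+\lambda\, c\prec X .$$
   Context: A dendriform algebra over $k$ is a $k$-vector space $D$ with bilinear operations $\prec,\succ$ such that for all $a,b,c\in D$: $(a\prec b)\prec c=a\prec(b\prec c+b\succ c)$, $(a\succ b)\prec c=a\succ(b\prec c)$, $a\succ(b\succ c)=(a\prec b+a\succ b)\succ c$. The product $a*b:=a\prec b+a\succ b$ is associative. The augmentation $\overline D=D\oplus k\mathbf 1$ is defined by $a\prec\mathbf 1=a=\mathbf 1\succ a$ and $\mathbf 1\prec a=0=a\succ\mathbf 1$ for $a\in D$ ($\mathbf 1\prec\mathbf 1$, $\mathbf 1\succ\mathbf 1$ undefined), with $\mathbf 1*\mathbf 1=\mathbf 1$. Operations are extended $\lambda$-bilinearly to $\overline D[[\lambda]]$. For $W$ with constant term $\mathbf 1$, $W^{-1}$ is its $*$-inverse. The expression $Y^{-1}\succ a\prec Z^{-1}$ means $(Y^{-1}\succ a)\prec Z^{-1}=Y^{-1}\succ(a\prec Z^{-1})$. *)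

theory Defs
  imports
    "HOL-Computational_Algebra.Formal_Power_Series"
    "HOL-Library.Product_Plus"
begin

unbundle fps_syntax

record ('k, 'd) dendriform =
  scal :: "'k \<Rightarrow> 'd \<Rightarrow> 'd"
  dprec :: "'d \<Rightarrow> 'd \<Rightarrow> 'd"  (infixl \<open>\<prec>\<index>\<close> 72)
  dsucc :: "'d \<Rightarrow> 'd \<Rightarrow> 'd"  (infixl \<open>\<succ>\<index>\<close> 72)

locale dendriform_algebra =
  fixes D :: "('k::field, 'd::ab_group_add) dendriform" (structure)
  assumes vector_space: "vector_space (scal D)"
    and linear_prec_left: "\<And>b. Vector_Spaces.linear (scal D) (scal D) (\<lambda>a. a \<prec> b)"
    and linear_prec_right: "\<And>a. Vector_Spaces.linear (scal D) (scal D) (\<lambda>b. a \<prec> b)"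
    and linear_succ_left: "\<And>b. Vector_Spaces.linear (scal D) (scal D) (\<lambda>a. a \<succ> b)"
    and linear_succ_right: "\<And>a. Vector_Spaces.linear (scal D) (scal D) (\<lambda>b. a \<succ> b)"
    and prec_prec: "\<And>a b c. (a \<prec> b) \<prec> c = a \<prec> (b \<prec> c + b \<succ> c)"
    and succ_prec: "\<And>a b c. (a \<succ> b) \<prec> c = a \<succ> (b \<prec> c)"
    and succ_succ: "\<And>a b c. a \<succ> (b \<succ> c) = (a \<prec> b + a \<succ> b) \<succ> c"

text \<open>
  The augmentation \<open>D \<oplus> k\<one>\<close> is the type \<^typ>\<open>'d \<times> 'k\<close>, the pair \<open>(a, s)\<close> standing
  for \<open>a + s\<one>\<close>.  The half-products extend bilinearly; the undefined products
  \<open>\<one> \<prec> \<one>\<close> and \<open>\<one> \<succ> \<one>\<close> are set to the unspecified element \<^const>\<open>undefined\<close>; they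
  contribute only when both factors have a nonzero \<open>\<one>\<close>-component.
\<close>

definition aug_scal :: "('k::field, 'd::ab_group_add) dendriform \<Rightarrow> 'k \<Rightarrow> 'd \<times> 'k \<Rightarrow> 'd \<times> 'k"
  where "aug_scal D r x = (scal D r (fst x), r * snd x)"

definition aug_prec ::
  "('k::field, 'd::ab_group_add) dendriform \<Rightarrow> 'd \<times> 'k \<Rightarrow> 'd \<times> 'k \<Rightarrow> 'd \<times> 'k"
  where "aug_prec D x y =
    (fst x \<prec>\<^bsub>D\<^esub> fst y + scal D (snd y) (fst x), 0) + aug_scal D (snd x * snd y) undefined"

definition aug_succ ::
  "('k::field, 'd::ab_group_add) dendriform \<Rightarrow> 'd \<times> 'k \<Rightarrow> 'd \<times> 'k \<Rightarrow> 'd \<times> 'k"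
  where "aug_succ D x y =
    (fst x \<succ>\<^bsub>D\<^esub> fst y + scal D (snd x) (fst y), 0) + aug_scal D (snd x * snd y) undefined"

definition aug_mult ::
  "('k::field, 'd::ab_group_add) dendriform \<Rightarrow> 'd \<times> 'k \<Rightarrow> 'd \<times> 'k \<Rightarrow> 'd \<times> 'k"
  where "aug_mult D x y =
    (fst x \<prec>\<^bsub>D\<^esub> fst y + fst x \<succ>\<^bsub>D\<^esub> fst y + scal D (snd y) (fst x) + scal D (snd x) (fst y),
     snd x * snd y)"

text \<open>
  Series over the augmentation are \<^typ>\<open>('d \<times> 'k) fps\<close>; only the additive structure of
  this type is used, as the products depend on \<open>D\<close>.
\<close>

definition series_ext :: "('a \<Rightarrow> 'a \<Rightarrow> 'a::comm_monoid_add) \<Rightarrow> 'a fps \<Rightarrow> 'a fps \<Rightarrow> 'a fps"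
  where "series_ext f F G = Abs_fps (\<lambda>n. \<Sum>i=0..n. f (F $ i) (G $ (n - i)))"

definition lambda_times :: "'a::zero fps \<Rightarrow> 'a fps"  (\<open>\<^bold>\<lambda> _\<close> [71] 70)
  where "\<^bold>\<lambda> F = Abs_fps (\<lambda>n. case n of 0 \<Rightarrow> 0 | Suc m \<Rightarrow> F $ m)"

definition series_one :: "('d::zero \<times> 'k::{zero,one}) fps"  (\<open>\<^bold>1\<close>)
  where "\<^bold>1 = fps_const (0, 1)"

definition series_of :: "'d::zero \<Rightarrow> ('d \<times> 'k::zero) fps"  (\<open>\<langle>_\<rangle>\<close>)
  where "\<langle>a\<rangle> = fps_const (a, 0)"

definition series_prec ::
  "('k::field, 'd::ab_group_add) dendriform \<Rightarrow> ('d \<times> 'k) fps \<Rightarrow> ('d \<times> 'k) fps \<Rightarrow> ('d \<times> 'k) fps"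
  (infixl \<open>\<^bold>\<prec>\<index>\<close> 72)
  where "F \<^bold>\<prec>\<^bsub>D\<^esub> G = series_ext (aug_prec D) F G"

definition series_succ ::
  "('k::field, 'd::ab_group_add) dendriform \<Rightarrow> ('d \<times> 'k) fps \<Rightarrow> ('d \<times> 'k) fps \<Rightarrow> ('d \<times> 'k) fps"
  (infixl \<open>\<^bold>\<succ>\<index>\<close> 72)
  where "F \<^bold>\<succ>\<^bsub>D\<^esub> G = series_ext (aug_succ D) F G"

definition series_mult ::
  "('k::field, 'd::ab_group_add) dendriform \<Rightarrow> ('d \<times> 'k) fps \<Rightarrow> ('d \<times> 'k) fps \<Rightarrow> ('d \<times> 'k) fps"
  (infixl \<open>\<^bold>*\<index>\<close> 72)
  where "F \<^bold>*\<^bsub>D\<^esub> G = series_ext (aug_mult D) F G"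

definition series_inv ::
  "('k::field, 'd::ab_group_add) dendriform \<Rightarrow> ('d \<times> 'k) fps \<Rightarrow> ('d \<times> 'k) fps"
  (\<open>_\<^sup>-\<^sup>1\<index>\<close> [1000] 999)
  where "W\<^sup>-\<^sup>1\<^bsub>D\<^esub> = (THE V. W \<^bold>*\<^bsub>D\<^esub> V = \<^bold>1 \<and> V \<^bold>*\<^bsub>D\<^esub> W = \<^bold>1)"

lemma aug_conventions:
  fixes D :: "('k::field, 'd::ab_group_add) dendriform"
  assumes "dendriform_algebra D"
  shows "aug_prec D (a, 0) (b, 0) = (a \<prec>\<^bsub>D\<^esub> b, 0)"
    and "aug_succ D (a, 0) (b, 0) = (a \<succ>\<^bsub>D\<^esub> b, 0)"
    and "aug_prec D (a, 0) (0, 1) = (a, 0)"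
    and "aug_succ D (0, 1) (a, 0) = (a, 0)"
    and "aug_prec D (0, 1) (a, 0) = 0"
    and "aug_succ D (a, 0) (0, 1) = 0"
    and "aug_prec D (0, 1) (0, 1) = undefined"
    and "aug_succ D (0, 1) (0, 1) = undefined"
    and "aug_mult D (a, 0) (b, 0) = (a \<prec>\<^bsub>D\<^esub> b + a \<succ>\<^bsub>D\<^esub> b, 0)"
    and "aug_mult D (0, 1) x = x"
    and "aug_mult D x (0, 1) = x"
proof -
  interpret dendriform_algebra D by fact
  interpret vs: vector_space "scal D" by (rule vector_space)
  interpret pl: Vector_Spaces.linear "scal D" "scal D" "\<lambda>a. a \<prec>\<^bsub>D\<^esub> b" for b
    by (rule linear_prec_left)
  interpret pr: Vector_Spaces.linear "scal D" "scal D" "\<lambda>b. a \<prec>\<^bsub>D\<^esub> b" for a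
    by (rule linear_prec_right)
  interpret sl: Vector_Spaces.linear "scal D" "scal D" "\<lambda>a. a \<succ>\<^bsub>D\<^esub> b" for b
    by (rule linear_succ_left)
  interpret sr: Vector_Spaces.linear "scal D" "scal D" "\<lambda>b. a \<succ>\<^bsub>D\<^esub> b" for a
    by (rule linear_succ_right)
  note simps = aug_prec_def aug_succ_def aug_mult_def aug_scal_def prod_eq_iff
    pl.zero pr.zero sl.zero sr.zero
  show "aug_prec D (a, 0) (b, 0) = (a \<prec>\<^bsub>D\<^esub> b, 0)" by (simp add: simps)
  show "aug_succ D (a, 0) (b, 0) = (a \<succ>\<^bsub>D\<^esub> b, 0)" by (simp add: simps)
  show "aug_prec D (a, 0) (0, 1) = (a, 0)" by (simp add: simps)
  show "aug_succ D (0, 1) (a, 0) = (a, 0)" by (simp add: simps)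
  show "aug_prec D (0, 1) (a, 0) = 0" by (simp add: simps)
  show "aug_succ D (a, 0) (0, 1) = 0" by (simp add: simps)
  show "aug_prec D (0, 1) (0, 1) = undefined" by (simp add: simps)
  show "aug_succ D (0, 1) (0, 1) = undefined" by (simp add: simps)
  show "aug_mult D (a, 0) (b, 0) = (a \<prec>\<^bsub>D\<^esub> b + a \<succ>\<^bsub>D\<^esub> b, 0)" by (simp add: simps)
  show "aug_mult D (0, 1) x = x" by (simp add: simps)
  show "aug_mult D x (0, 1) = x" by (simp add: simps)
qed

lemma series_succ_prec:
  fixes D :: "('k::field, 'd::ab_group_add) dendriform" and a :: 'd and F G :: "('d \<times> 'k) fps"
  assumes "dendriform_algebra D"
  shows "(F \<^bold>\<succ>\<^bsub>D\<^esub> \<langle>a\<rangle>) \<^bold>\<prec>\<^bsub>D\<^esub> G = F \<^bold>\<succ>\<^bsub>D\<^esub> (\<langle>a\<rangle> \<^bold>\<prec>\<^bsub>D\<^esub> G)"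
proof -
  interpret dendriform_algebra D by fact
  interpret vs: vector_space "scal D" by (rule vector_space)
  interpret pl: Vector_Spaces.linear "scal D" "scal D" "\<lambda>a. a \<prec>\<^bsub>D\<^esub> b" for b
    by (rule linear_prec_left)
  interpret pr: Vector_Spaces.linear "scal D" "scal D" "\<lambda>b. a \<prec>\<^bsub>D\<^esub> b" for a
    by (rule linear_prec_right)
  interpret sl: Vector_Spaces.linear "scal D" "scal D" "\<lambda>a. a \<succ>\<^bsub>D\<^esub> b" for b
    by (rule linear_succ_left)
  interpret sr: Vector_Spaces.linear "scal D" "scal D" "\<lambda>b. a \<succ>\<^bsub>D\<^esub> b" for a
    by (rule linear_succ_right)
  have z: "aug_succ D x 0 = 0" "aug_prec D 0 x = 0" for x
    by (simp_all add: aug_prec_def aug_succ_def aug_scal_def prod_eq_iff pl.zero sr.zero)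
  have e: "aug_prec D (aug_succ D x (a, 0)) y = aug_succ D x (aug_prec D (a, 0) y)" for x y
    by (simp add: aug_prec_def aug_succ_def aug_scal_def prod_eq_iff pl.zero sr.zero
        pl.add sr.add pl.scale sr.scale vs.scale_right_distrib succ_prec ac_simps)
  have l: "(F \<^bold>\<succ>\<^bsub>D\<^esub> \<langle>a\<rangle>) $ n = aug_succ D (F $ n) (a, 0)" for n
  proof -
    have "(F \<^bold>\<succ>\<^bsub>D\<^esub> \<langle>a\<rangle>) $ n = (\<Sum>i=0..n. if i = n then aug_succ D (F $ n) (a, 0) else 0)"
      unfolding series_succ_def series_ext_def series_of_def fps_nth_Abs_fps
      by (rule sum.cong) (auto simp: z)
    then show ?thesis by simp
  qed
  have r: "(\<langle>a\<rangle> \<^bold>\<prec>\<^bsub>D\<^esub> G) $ n = aug_prec D (a, 0) (G $ n)" for n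
  proof -
    have "(\<langle>a\<rangle> \<^bold>\<prec>\<^bsub>D\<^esub> G) $ n = (\<Sum>i=0..n. if i = 0 then aug_prec D (a, 0) (G $ n) else 0)"
      unfolding series_prec_def series_ext_def series_of_def fps_nth_Abs_fps
      by (rule sum.cong) (auto simp: z)
    then show ?thesis by simp
  qed
  have "(F \<^bold>\<succ>\<^bsub>D\<^esub> \<langle>a\<rangle>) \<^bold>\<prec>\<^bsub>D\<^esub> G = series_ext (\<lambda>x y. aug_prec D (aug_succ D x (a, 0)) y) F G"
    by (simp add: fps_eq_iff series_prec_def series_ext_def l)
  also have "\<dots> = F \<^bold>\<succ>\<^bsub>D\<^esub> (\<langle>a\<rangle> \<^bold>\<prec>\<^bsub>D\<^esub> G)"
    by (simp add: fps_eq_iff series_succ_def series_ext_def r e)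
  finally show "(F \<^bold>\<succ>\<^bsub>D\<^esub> \<langle>a\<rangle>) \<^bold>\<prec>\<^bsub>D\<^esub> G = F \<^bold>\<succ>\<^bsub>D\<^esub> (\<langle>a\<rangle> \<^bold>\<prec>\<^bsub>D\<^esub> G)" .
qed

end

theory Submission
  imports Defs
begin

text \<open>
  Let \<open>A = Y\<^sup>-\<^sup>1 \<succ> a \<prec> Z\<^sup>-\<^sup>1\<close>, a series without \<open>\<one>\<close>-component. The equation for \<open>Y\<close> turns
  left multiplication into \<open>Y * U = \<lambda> c \<prec> (Y * U) + Y \<succ> U\<close>, and the one for \<open>Z\<close> turns right
  multiplication into \<open>U * Z = U \<prec> Z + \<lambda> (U * Z) \<succ> b\<close>, for every such series \<open>U\<close>. Hence
  \<open>X = \<lambda> c \<prec> X + Y \<succ> (A * Z) = \<lambda> c \<prec> X + Y \<succ> A \<prec> Z + \<lambda> X \<succ> b\<close>,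
  and \<open>Y \<succ> A \<prec> Z = (Y * Y\<^sup>-\<^sup>1) \<succ> a \<prec> (Z\<^sup>-\<^sup>1 * Z) = a\<close>.
\<close>

section \<open>Cauchy products of a biadditive operation\<close>

definition biadditive :: "('a::ab_group_add \<Rightarrow> 'a \<Rightarrow> 'a) \<Rightarrow> bool"
  where "biadditive f \<longleftrightarrow>
    (\<forall>x y z. f (x + y) z = f x z + f y z) \<and> (\<forall>x y z. f x (y + z) = f x y + f x z)"

lemma biadditive_add:
  assumes "biadditive f"
  shows "f (x + y) z = f x z + f y z" and "f x (y + z) = f x y + f x z"
  using assms by (auto simp: biadditive_def)

lemma biadditive_zero:
  assumes "biadditive f"
  shows "f 0 x = 0" and "f x 0 = 0"
  using biadditive_add(1)[OF assms, of 0 0 x] biadditive_add(2)[OF assms, of x 0 0] by auto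

lemma biadditive_sum:
  assumes "biadditive f"
  shows "f (sum g S) x = (\<Sum>i\<in>S. f (g i) x)" and "f x (sum g S) = (\<Sum>i\<in>S. f x (g i))"
  by (induction S rule: infinite_finite_induct)
    (simp_all add: biadditive_add[OF assms] biadditive_zero[OF assms])

lemma series_ext_nth: "series_ext f F G $ n = (\<Sum>i=0..n. f (F $ i) (G $ (n - i)))"
  by (simp add: series_ext_def)

text \<open>Passing to the opposite operation lets right-handed statements follow from their
  left-handed versions.\<close>

lemma series_ext_flip: "series_ext (\<lambda>x y. f y x) F G = series_ext f G F"
proof (rule fps_ext)
  fix n
  show "series_ext (\<lambda>x y. f y x) F G $ n = series_ext f G F $ n"
    unfolding series_ext_nth
    by (rule sum.reindex_bij_witness[of _ "\<lambda>i. n - i" "\<lambda>i. n - i"]) auto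
qed

lemma biadditive_series_ext:
  assumes "biadditive f"
  shows "biadditive (series_ext f)"
  by (simp add: biadditive_def fps_eq_iff series_ext_nth biadditive_add[OF assms] sum.distrib)

text \<open>Both sides sum over triples with i + j + k = n. Four operations are allowed because the
  dendriform laws mix \<prec>, \<succ> and *. The law is asked only of coefficients of
  \<open>F\<close>, \<open>G\<close>, \<open>H\<close>, since some laws are available only for
  elements without \<one>-component.\<close>

lemma series_ext_assoc:
  assumes "biadditive f" and "biadditive h"
    and "\<And>i j k. f (g (F $ i) (G $ j)) (H $ k) = h (F $ i) (l (G $ j) (H $ k))"
  shows "series_ext f (series_ext g F G) H = series_ext h F (series_ext l G H)"
proof (rule fps_ext)
  fix n
  have "series_ext f (series_ext g F G) H $ n
      = (\<Sum>j=0..n. \<Sum>i=0..j. h (F $ i) (l (G $ (j - i)) (H $ (n - j))))"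
    by (simp add: series_ext_nth biadditive_sum(1)[OF assms(1)] assms(3))
  also have "\<dots> = (\<Sum>j=0..n. \<Sum>i=0..n - j. h (F $ j) (l (G $ i) (H $ (n - j - i))))"
    by (rule fps_mult_assoc_lemma)
  also have "\<dots> = series_ext h F (series_ext l G H) $ n"
    by (simp add: series_ext_nth biadditive_sum(2)[OF assms(2)])
  finally show "series_ext f (series_ext g F G) H $ n = series_ext h F (series_ext l G H) $ n" .
qed

lemma series_ext_const_left:
  assumes "biadditive f"
  shows "series_ext f (fps_const e) F $ n = f e (F $ n)"
proof -
  have "series_ext f (fps_const e) F $ n = (\<Sum>i=0..n. if i = 0 then f e (F $ n) else 0)"
    unfolding series_ext_nth by (rule sum.cong) (auto simp: biadditive_zero[OF assms])
  then show ?thesis by simp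
qed

lemma series_ext_const_right:
  assumes "biadditive f"
  shows "series_ext f F (fps_const e) $ n = f (F $ n) e"
proof -
  have "biadditive (\<lambda>x y. f y x)" using assms by (simp add: biadditive_def)
  from series_ext_const_left[OF this] show ?thesis by (simp add: series_ext_flip[of f])
qed

lemma lambda_times_nth [simp]: "(\<^bold>\<lambda> F) $ 0 = 0" "(\<^bold>\<lambda> F) $ Suc n = F $ n"
  by (simp_all add: lambda_times_def)

lemma lambda_times_add: "\<^bold>\<lambda> (F + G) = \<^bold>\<lambda> F + \<^bold>\<lambda> (G :: 'a::monoid_add fps)"
proof (rule fps_ext)
  fix n
  show "(\<^bold>\<lambda> (F + G)) $ n = (\<^bold>\<lambda> F + \<^bold>\<lambda> G) $ n" by (cases n) simp_all
qed

lemma series_ext_lambda_left: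
  assumes "biadditive f"
  shows "series_ext f (\<^bold>\<lambda> F) G = \<^bold>\<lambda> (series_ext f F G)"
proof (rule fps_ext)
  fix n
  show "series_ext f (\<^bold>\<lambda> F) G $ n = (\<^bold>\<lambda> (series_ext f F G)) $ n"
    \<comment> \<open>The index 0 contributes nothing because the shifted series starts with 0; the
      remaining sum is the previous coefficient.\<close>
    by (cases n)
      (simp_all add: series_ext_nth biadditive_zero[OF assms] sum.atLeast0_atMost_Suc_shift
        del: sum.cl_ivl_Suc)
qed

lemma series_ext_lambda_right:
  assumes "biadditive f"
  shows "series_ext f F (\<^bold>\<lambda> G) = \<^bold>\<lambda> (series_ext f F G)"
proof -
  have "biadditive (\<lambda>x y. f y x)" using assms by (simp add: biadditive_def)
  from series_ext_lambda_left[OF this, of G F] show ?thesis by (simp add: series_ext_flip[of f])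
qed

text \<open>Solves W * V = e coefficient by coefficient: as \<open>W $ 0 = e\<close> is a left unit,
  the vanishing of coefficient n + 1 of the product determines V at n + 1 from the earlier
  coefficients.\<close>

fun right_inverse_coeff :: "('a \<Rightarrow> 'a \<Rightarrow> 'a) \<Rightarrow> 'a \<Rightarrow> 'a::ab_group_add fps \<Rightarrow> nat \<Rightarrow> 'a"
  where "right_inverse_coeff f e W 0 = e"
  | "right_inverse_coeff f e W (Suc n) =
      - (\<Sum>i=0..n. f (W $ Suc i) (right_inverse_coeff f e W (n - i)))"

lemma ex_right_inverse:
  fixes f :: "'a \<Rightarrow> 'a \<Rightarrow> 'a::ab_group_add"
  assumes "\<And>x. f e x = x" and "W $ 0 = e"
  shows "\<exists>V. series_ext f W V = fps_const e"
proof
  show "series_ext f W (Abs_fps (right_inverse_coeff f e W)) = fps_const e"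
  proof (rule fps_ext)
    fix n
    show "series_ext f W (Abs_fps (right_inverse_coeff f e W)) $ n = fps_const e $ n"
      \<comment> \<open>Splitting off index 0 isolates the newest coefficient of the inverse;
        \<open>sum.cl_ivl_Suc\<close> would split off the last index instead.\<close>
      by (cases n) (simp_all add: series_ext_nth assms sum.atLeast0_atMost_Suc_shift
        del: sum.cl_ivl_Suc)
  qed
qed

lemma ex_left_inverse:
  fixes f :: "'a \<Rightarrow> 'a \<Rightarrow> 'a::ab_group_add"
  assumes "\<And>x. f x e = x" and "W $ 0 = e"
  shows "\<exists>V. series_ext f V W = fps_const e"
  using ex_right_inverse[of "\<lambda>x y. f y x", OF assms] by (simp add: series_ext_flip[of f])

section \<open>Dendriform laws on the augmentation and on series\<close>

context dendriform_algebra
begin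

sublocale vs: vector_space "scal D"
  by (rule vector_space)

lemma bilinear_prec:
  "(x + y) \<prec> z = x \<prec> z + y \<prec> z" "x \<prec> (y + z) = x \<prec> y + x \<prec> z"
  "scal D r x \<prec> y = scal D r (x \<prec> y)" "x \<prec> scal D r y = scal D r (x \<prec> y)"
  using linear_prec_left[of z] linear_prec_left[of y] linear_prec_right[of x]
  by (simp_all add: Vector_Spaces.linear_iff)

lemma bilinear_succ:
  "(x + y) \<succ> z = x \<succ> z + y \<succ> z" "x \<succ> (y + z) = x \<succ> y + x \<succ> z"
  "scal D r x \<succ> y = scal D r (x \<succ> y)" "x \<succ> scal D r y = scal D r (x \<succ> y)"
  using linear_succ_left[of z] linear_succ_left[of y] linear_succ_right[of x]
  by (simp_all add: Vector_Spaces.linear_iff)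

lemma half_products_zero: "0 \<prec> x = 0" "x \<prec> 0 = 0" "0 \<succ> x = 0" "x \<succ> 0 = 0"
  using bilinear_prec(1,2)[of 0 0 x] bilinear_prec(2)[of x 0 0]
    bilinear_succ(1,2)[of 0 0 x] bilinear_succ(2)[of x 0 0] by auto

lemmas aug_simps = aug_prec_def aug_succ_def aug_mult_def aug_scal_def prod_eq_iff
  bilinear_prec bilinear_succ half_products_zero

lemma biadditive_aug: "biadditive (aug_prec D)" "biadditive (aug_succ D)" "biadditive (aug_mult D)"
  by (simp_all add: biadditive_def aug_simps vs.scale_left_distrib vs.scale_right_distrib
      algebra_simps)

text \<open>With \<open>snd x = 0\<close> the arbitrary value of \<one> \<prec> \<one> is always
  scaled by 0, leaving the first axiom and the unit rules. The law for \<succ> below is the mirror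
  image, with the condition on the rightmost factor.\<close>

lemma aug_prec_prec: "snd x = 0 \<Longrightarrow> aug_prec D (aug_prec D x y) z = aug_prec D x (aug_mult D y z)"
  by (simp add: aug_simps prec_prec vs.scale_right_distrib algebra_simps)

lemma aug_succ_succ: "snd z = 0 \<Longrightarrow> aug_succ D (aug_mult D x y) z = aug_succ D x (aug_succ D y z)"
  by (simp add: aug_simps succ_succ vs.scale_right_distrib algebra_simps)

text \<open>On D this is the sum of the three dendriform axioms, and \<one> is a two-sided unit for
  *.\<close>

lemma aug_mult_assoc: "aug_mult D (aug_mult D x y) z = aug_mult D x (aug_mult D y z)"
  by (simp add: aug_simps prec_prec succ_prec succ_succ vs.scale_right_distrib algebra_simps)

text \<open>The pair \<one>, \<one> must be excluded: there * gives \<one>, while the half-products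
  are arbitrary.\<close>

lemma aug_mult_eq: "snd x = 0 \<or> snd y = 0 \<Longrightarrow> aug_mult D x y = aug_prec D x y + aug_succ D x y"
  by (auto simp: aug_simps)

lemma series_prec_prec:
  assumes "\<And>n. snd (F $ n) = 0"
  shows "(F \<^bold>\<prec> G) \<^bold>\<prec> H = F \<^bold>\<prec> (G \<^bold>* H)"
  unfolding series_prec_def series_mult_def
  by (rule series_ext_assoc) (simp_all add: biadditive_aug aug_prec_prec assms)

lemma series_succ_succ:
  assumes "\<And>n. snd (H $ n) = 0"
  shows "(F \<^bold>* G) \<^bold>\<succ> H = F \<^bold>\<succ> (G \<^bold>\<succ> H)"
  unfolding series_succ_def series_mult_def
  by (rule series_ext_assoc) (simp_all add: biadditive_aug aug_succ_succ assms)

lemma series_mult_assoc: "(F \<^bold>* G) \<^bold>* H = F \<^bold>* (G \<^bold>* H)"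
  unfolding series_mult_def
  by (rule series_ext_assoc) (simp_all add: biadditive_aug aug_mult_assoc)

lemma series_mult_eq:
  assumes "(\<forall>n. snd (F $ n) = 0) \<or> (\<forall>n. snd (G $ n) = 0)"
  shows "F \<^bold>* G = F \<^bold>\<prec> G + F \<^bold>\<succ> G"
proof -
  have "aug_mult D (F $ i) (G $ j) = aug_prec D (F $ i) (G $ j) + aug_succ D (F $ i) (G $ j)" for i j
    by (rule aug_mult_eq) (use assms in blast)
  then show ?thesis
    by (simp add: fps_eq_iff series_prec_def series_succ_def series_mult_def series_ext_nth
        sum.distrib)
qed

lemma series_add:
  "(F + G) \<^bold>\<prec> H = F \<^bold>\<prec> H + G \<^bold>\<prec> H" "F \<^bold>\<prec> (G + H) = F \<^bold>\<prec> G + F \<^bold>\<prec> H"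
  "(F + G) \<^bold>\<succ> H = F \<^bold>\<succ> H + G \<^bold>\<succ> H" "F \<^bold>\<succ> (G + H) = F \<^bold>\<succ> G + F \<^bold>\<succ> H"
  "(F + G) \<^bold>* H = F \<^bold>* H + G \<^bold>* H" "F \<^bold>* (G + H) = F \<^bold>* G + F \<^bold>* H"
  unfolding series_prec_def series_succ_def series_mult_def
  by (simp_all only: biadditive_add biadditive_series_ext biadditive_aug)

lemma series_lambda:
  "(\<^bold>\<lambda> F) \<^bold>\<prec> G = \<^bold>\<lambda> (F \<^bold>\<prec> G)" "F \<^bold>\<prec> (\<^bold>\<lambda> G) = \<^bold>\<lambda> (F \<^bold>\<prec> G)"
  "(\<^bold>\<lambda> F) \<^bold>\<succ> G = \<^bold>\<lambda> (F \<^bold>\<succ> G)" "F \<^bold>\<succ> (\<^bold>\<lambda> G) = \<^bold>\<lambda> (F \<^bold>\<succ> G)"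
  "(\<^bold>\<lambda> F) \<^bold>* G = \<^bold>\<lambda> (F \<^bold>* G)" "F \<^bold>* (\<^bold>\<lambda> G) = \<^bold>\<lambda> (F \<^bold>* G)"
  unfolding series_prec_def series_succ_def series_mult_def
  by (simp_all only: series_ext_lambda_left series_ext_lambda_right biadditive_aug)

lemma series_mult_one: "\<^bold>1 \<^bold>* F = F" "F \<^bold>* \<^bold>1 = F"
  by (simp_all add: fps_eq_iff series_mult_def series_one_def biadditive_aug
      series_ext_const_left series_ext_const_right aug_simps)

lemma series_prec_one:
  assumes "\<And>n. snd (F $ n) = 0"
  shows "F \<^bold>\<prec> \<^bold>1 = F"
  by (simp add: fps_eq_iff series_prec_def series_one_def biadditive_aug
      series_ext_const_right aug_simps assms)

lemma one_series_succ:
  assumes "\<And>n. snd (F $ n) = 0"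
  shows "\<^bold>1 \<^bold>\<succ> F = F"
  by (simp add: fps_eq_iff series_succ_def series_one_def biadditive_aug
      series_ext_const_left aug_simps assms)

lemma snd_series_of [simp]: "snd (\<langle>x\<rangle> $ n) = 0"
  by (simp add: series_of_def)

text \<open>A \<one>-component can come only from pairs in which both factors have one. This closure
  and the next two supply the side conditions of the series laws.\<close>

lemma snd_series_prec:
  assumes "\<And>n. snd (F $ n) = 0"
  shows "snd ((F \<^bold>\<prec> G) $ n) = 0"
  by (simp add: series_prec_def series_ext_nth aug_simps assms snd_sum)

lemma snd_series_succ:
  assumes "\<And>n. snd (G $ n) = 0"
  shows "snd ((F \<^bold>\<succ> G) $ n) = 0"
  by (simp add: series_succ_def series_ext_nth aug_simps assms snd_sum)

lemma snd_series_mult: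
  assumes "\<And>n. snd (F $ n) = 0"
  shows "snd ((F \<^bold>* G) $ n) = 0"
  by (simp add: series_mult_def series_ext_nth aug_simps assms snd_sum)

text \<open>The description defining the inverse needs existence and uniqueness. One-sided inverses
  exist on either side, and associativity identifies them.\<close>

lemma series_inv:
  assumes "W $ 0 = (0, 1)"
  shows "W \<^bold>* W\<^sup>-\<^sup>1 = \<^bold>1" and "W\<^sup>-\<^sup>1 \<^bold>* W = \<^bold>1"
proof -
  have unit: "aug_mult D (0, 1) x = x" "aug_mult D x (0, 1) = x" for x
    by (simp_all add: aug_simps)
  obtain V where V: "W \<^bold>* V = \<^bold>1"
    using ex_right_inverse[of "aug_mult D", OF unit(1) assms]
    by (auto simp: series_mult_def series_one_def)
  obtain U where U: "U \<^bold>* W = \<^bold>1"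
    using ex_left_inverse[of "aug_mult D", OF unit(2) assms]
    by (auto simp: series_mult_def series_one_def)
  \<comment> \<open>V' = (U * W) * V' = U * (W * V') = U.\<close>
  have uniq: "V' = U" if "W \<^bold>* V' = \<^bold>1" for V'
    using series_mult_assoc[of U W V'] that U by (simp add: series_mult_one)
  have "\<exists>!V. W \<^bold>* V = \<^bold>1 \<and> V \<^bold>* W = \<^bold>1"
    using U V uniq by metis
  from theI'[OF this] show "W \<^bold>* W\<^sup>-\<^sup>1 = \<^bold>1" "W\<^sup>-\<^sup>1 \<^bold>* W = \<^bold>1"
    by (simp_all add: series_inv_def)
qed

text \<open>Expand the left factor \<open>Y\<close> once and split (c \<prec> Y) * U into
  half-products. The \<prec>-half is c \<prec> (Y * U) by the first axiom; the \<succ>-half joins U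
  = \<one> \<succ> U, and the equation for \<open>Y\<close> folds them into Y \<succ> U.\<close>

lemma left_factor_mult:
  assumes Y: "Y = \<^bold>1 + \<^bold>\<lambda> (\<langle>c\<rangle> \<^bold>\<prec> Y)" and U: "\<And>n. snd (U $ n) = 0"
  shows "Y \<^bold>* U = \<^bold>\<lambda> (\<langle>c\<rangle> \<^bold>\<prec> (Y \<^bold>* U)) + Y \<^bold>\<succ> U"
proof -
  have "Y \<^bold>* U = U + \<^bold>\<lambda> ((\<langle>c\<rangle> \<^bold>\<prec> Y) \<^bold>* U)"
    \<comment> \<open>A single substitution is made because the equation for \<open>Y\<close> is
      recursive and would loop as a rewrite rule.\<close>
    by (subst Y) (simp add: series_add series_lambda series_mult_one)
  also have "(\<langle>c\<rangle> \<^bold>\<prec> Y) \<^bold>* U = \<langle>c\<rangle> \<^bold>\<prec> (Y \<^bold>* U) + (\<langle>c\<rangle> \<^bold>\<prec> Y) \<^bold>\<succ> U"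
    by (simp add: series_mult_eq[of "\<langle>c\<rangle> \<^bold>\<prec> Y"] snd_series_prec series_prec_prec)
  also have "U + \<^bold>\<lambda> (\<langle>c\<rangle> \<^bold>\<prec> (Y \<^bold>* U) + (\<langle>c\<rangle> \<^bold>\<prec> Y) \<^bold>\<succ> U)
      = \<^bold>\<lambda> (\<langle>c\<rangle> \<^bold>\<prec> (Y \<^bold>* U)) + (\<^bold>1 + \<^bold>\<lambda> (\<langle>c\<rangle> \<^bold>\<prec> Y)) \<^bold>\<succ> U"
    by (simp add: series_add series_lambda lambda_times_add one_series_succ U algebra_simps)
  finally show ?thesis by (simp only: Y[symmetric])
qed

text \<open>Mirror image: the third axiom turns U \<succ> (Z \<succ> b) into (U * Z) \<succ> b, and
  U = U \<prec> \<one> joins U \<prec> (Z \<succ> b) to give U \<prec> Z.\<close>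

lemma right_factor_mult:
  assumes Z: "Z = \<^bold>1 + \<^bold>\<lambda> (Z \<^bold>\<succ> \<langle>b\<rangle>)" and U: "\<And>n. snd (U $ n) = 0"
  shows "U \<^bold>* Z = U \<^bold>\<prec> Z + \<^bold>\<lambda> ((U \<^bold>* Z) \<^bold>\<succ> \<langle>b\<rangle>)"
proof -
  have "U \<^bold>* Z = U + \<^bold>\<lambda> (U \<^bold>* (Z \<^bold>\<succ> \<langle>b\<rangle>))"
    by (subst Z) (simp add: series_add series_lambda series_mult_one)
  also have "U \<^bold>* (Z \<^bold>\<succ> \<langle>b\<rangle>) = U \<^bold>\<prec> (Z \<^bold>\<succ> \<langle>b\<rangle>) + (U \<^bold>* Z) \<^bold>\<succ> \<langle>b\<rangle>"
    by (simp add: series_mult_eq[of U "Z \<^bold>\<succ> \<langle>b\<rangle>"] snd_series_succ series_succ_succ)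
  also have "U + \<^bold>\<lambda> (U \<^bold>\<prec> (Z \<^bold>\<succ> \<langle>b\<rangle>) + (U \<^bold>* Z) \<^bold>\<succ> \<langle>b\<rangle>)
      = U \<^bold>\<prec> (\<^bold>1 + \<^bold>\<lambda> (Z \<^bold>\<succ> \<langle>b\<rangle>)) + \<^bold>\<lambda> ((U \<^bold>* Z) \<^bold>\<succ> \<langle>b\<rangle>)"
    by (simp add: series_add series_lambda lambda_times_add series_prec_one U algebra_simps)
  finally show ?thesis by (simp only: Z[symmetric])
qed

end

theorem mainTheorem3:
  fixes D :: "('k::field_char_0, 'd::ab_group_add) dendriform" (structure)
    and a b c :: 'd
    and X Y Z :: "('d \<times> 'k) fps"
  assumes "dendriform_algebra D"
    and "Y = \<^bold>1 + \<^bold>\<lambda> (\<langle>c\<rangle> \<^bold>\<prec> Y)"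
    and "Z = \<^bold>1 + \<^bold>\<lambda> (Z \<^bold>\<succ> \<langle>b\<rangle>)"
    and "X = Y \<^bold>* ((Y\<^sup>-\<^sup>1 \<^bold>\<succ> \<langle>a\<rangle>) \<^bold>\<prec> Z\<^sup>-\<^sup>1) \<^bold>* Z"
  shows "X = \<langle>a\<rangle> + \<^bold>\<lambda> (X \<^bold>\<succ> \<langle>b\<rangle>) + \<^bold>\<lambda> (\<langle>c\<rangle> \<^bold>\<prec> X)"
proof -
  interpret dendriform_algebra D by fact
  note Y = assms(2) and Z = assms(3)
  \<comment> \<open>The shift by \<lambda> has constant term 0, so \<open>Y\<close> and
    \<open>Z\<close> start with \<one> and are invertible.\<close>
  have Y0: "Y $ 0 = (0, 1)" by (subst Y) (simp add: series_one_def)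
  have Z0: "Z $ 0 = (0, 1)" by (subst Z) (simp add: series_one_def)
  define A where "A = (Y\<^sup>-\<^sup>1 \<^bold>\<succ> \<langle>a\<rangle>) \<^bold>\<prec> Z\<^sup>-\<^sup>1"
  have X: "X = Y \<^bold>* (A \<^bold>* Z)"
    using assms(4) by (simp add: A_def series_mult_assoc)
  have A: "snd (A $ n) = 0" for n
    by (simp add: A_def snd_series_prec snd_series_succ)
  \<comment> \<open>The first axiom moves \<open>Z\<close> onto its inverse: (u \<prec> V) \<prec> Z
    = u \<prec> (V * Z) = u, where V is the inverse of \<open>Z\<close>.\<close>
  have "A \<^bold>\<prec> Z = Y\<^sup>-\<^sup>1 \<^bold>\<succ> \<langle>a\<rangle>"
    by (simp add: A_def series_prec_prec snd_series_succ series_inv(2)[OF Z0] series_prec_one)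
  then have YAZ: "Y \<^bold>\<succ> (A \<^bold>\<prec> Z) = \<langle>a\<rangle>"
    by (simp add: series_succ_succ[symmetric] series_inv(1)[OF Y0] one_series_succ)
  have "Y \<^bold>\<succ> (A \<^bold>* Z) = Y \<^bold>\<succ> (A \<^bold>\<prec> Z) + \<^bold>\<lambda> (Y \<^bold>\<succ> ((A \<^bold>* Z) \<^bold>\<succ> \<langle>b\<rangle>))"
    by (subst right_factor_mult[OF Z A]) (simp add: series_add series_lambda)
  also have "\<dots> = \<langle>a\<rangle> + \<^bold>\<lambda> (X \<^bold>\<succ> \<langle>b\<rangle>)"
    \<comment> \<open>The third axiom gives Y \<succ> ((A * Z) \<succ> b) = (Y * (A * Z)) \<succ> b,
      whose left factor is \<open>X\<close>.\<close>
    by (simp add: YAZ X series_succ_succ)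
  finally have "Y \<^bold>\<succ> (A \<^bold>* Z) = \<langle>a\<rangle> + \<^bold>\<lambda> (X \<^bold>\<succ> \<langle>b\<rangle>)" .
  moreover have "X = \<^bold>\<lambda> (\<langle>c\<rangle> \<^bold>\<prec> X) + Y \<^bold>\<succ> (A \<^bold>* Z)"
    \<comment> \<open>The left factor lemma is applied with U = A * Z, which inherits from
      \<open>A\<close> the absence of a \<one>-component.\<close>
    unfolding X by (rule left_factor_mult[OF Y snd_series_mult[OF A]])
  ultimately show ?thesis by (simp add: algebra_simps)
qed

end
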